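(* Let $X$ be a real reflexive Banach space with dual space $X^*$, let $n\in\{2,3,\dots\}$, and let $S:X\rightrightarrows X^*$ be an $n$-monotone set-valued operator with $G(S)\neq\emptyset$. Suppose that $\langle x^*,x\rangle\le F_{S,n}^*(x^*,x)$ for all $(x^*,x)\in X^*\times X$. Let $B:X\to X^*$ be a linear, continuous, monotone and strongly coercive operator. Then for every $w^*\in X^*$ there exists $x\in\operatorname{cl}\operatorname{co}D(S)$ such that $\{(x,w^*-Bx)\}\cup G(S)$ is $n$-monotone.
   Context: $\langle x^*,x\rangle$ denotes the value of $x^*\in X^*$ at $x\in X$; $\overline{\mathbb{R}}=\mathbb{R}\cup\{\pm\infty\}$; $\operatorname{cl}$ and $\operatorname{co}$ denote (norm) closure and convex hull. For a set-valued operator $S:X\rightrightarrows X^*$, the graph is $G(S)=\{(x,x^* )\in X\times X^*: x^*\in S(x)\}$ and the domain is $D(S)=\{x\in X:S(x)\neq\emptyset\}$. For an integer $n\ge 2$, $S$ is $n$-monotone (also called $n$-cyclically monotone) if $\sum_{i=1}^n\langle s_i^*,s_{i+1}-s_i\rangle\le 0$ for all $(s_1,s_1^* ),\dots,(s_n,s_n^* )\in G(S)$, where $s_{n+1}=s_1$. A subset of $X\times X^*$ is called $n$-monotone if the operator having it as its graph is $n$-monotone. Monotone means $2$-monotone; for a linear operator $B:X\to X^*$ this means $\langle Bx,x\rangle\ge 0$ for all $x\in X$. The Fitzpatrick function of order $n$ of $S$ is $F_{S,n}:X\times X^*\to\overline{\mathbb{R}}$, $$F_{S,n}(x,x^* )=\sup\Big\{\sum_{i=1}^{n-2}\langle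 s_i^*,s_{i+1}-s_i\rangle+\langle s_{n-1}^*,x-s_{n-1}\rangle+\langle x^*,s_1\rangle : (s_i,s_i^* )\in G(S),\ i=1,\dots,n-1\Big\}$$ (for $n=2$ the sum over $i$ is empty). Identifying $X^{**}$ with $X$ by reflexivity, its Fenchel conjugate is $F_{S,n}^*:X^*\times X\to\overline{\mathbb{R}}$, $F_{S,n}^*(x^*,x)=\sup_{(y,y^* )\in X\times X^*}\{\langle x^*,y\rangle+\langle y^*,x\rangle-F_{S,n}(y,y^* )\}$. A linear continuous operator $B:X\to X^*$ is strongly coercive if $\lim_{\|x\|\to+\infty}\langle Bx,x\rangle/\|x\|=+\infty$. *)

theory Defs
  imports "HOL-Analysis.Analysis"
begin

type_synonym 'a dual = "'a \<Rightarrow>\<^sub>L real"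

text \<open>Reflexivity: every element of the bidual is evaluation at a point, i.e. the canonical
  embedding into the bidual is onto.\<close>

definition reflexive_space :: "'a::real_normed_vector itself \<Rightarrow> bool" where
  "reflexive_space _ \<longleftrightarrow>
     (\<forall>\<phi> :: 'a dual \<Rightarrow>\<^sub>L real. \<exists>x::'a. \<forall>f. blinfun_apply \<phi> f = blinfun_apply f x)"

definition op_graph :: "('a \<Rightarrow> 'b set) \<Rightarrow> ('a \<times> 'b) set" where
  "op_graph S = {(x, x'). x' \<in> S x}"

definition op_dom :: "('a \<Rightarrow> 'b set) \<Rightarrow> 'a set" where
  "op_dom S = {x. S x \<noteq> {}}"

text \<open>Points of \<open>G\<close> are written \<open>(s i, s' i)\<close> for \<open>i = 1, \<dots>, n\<close>; the value \<open>s (n + 1)\<close> is not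
  a further point but is constrained to close the cycle. An operator is \<open>n\<close>-monotone when its
  graph is. The notion is meant for \<open>n \<ge> 2\<close>.\<close>

definition n_monotone :: "nat \<Rightarrow> ('a::real_normed_vector \<times> 'a dual) set \<Rightarrow> bool" where
  "n_monotone n G \<longleftrightarrow>
     (\<forall>(s :: nat \<Rightarrow> 'a) (s' :: nat \<Rightarrow> 'a dual).
        (\<forall>i\<in>{1..n}. (s i, s' i) \<in> G) \<and> s (n + 1) = s 1 \<longrightarrow>
        (\<Sum>i=1..n. blinfun_apply (s' i) (s (i + 1) - s i)) \<le> 0)"

definition monotone_operator :: "('a::real_normed_vector \<Rightarrow> 'a dual) \<Rightarrow> bool" where
  "monotone_operator B \<longleftrightarrow> n_monotone 2 (op_graph (\<lambda>x. {B x}))"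

lemma monotone_operator_linear_iff:
  fixes B :: "'a::real_normed_vector \<Rightarrow> 'a dual"
  assumes "linear B"
  shows "monotone_operator B \<longleftrightarrow> (\<forall>x. blinfun_apply (B x) x \<ge> 0)"
proof
  assume m: "monotone_operator B"
  show "\<forall>x. blinfun_apply (B x) x \<ge> 0"
  proof
    fix x :: 'a
    define s :: "nat \<Rightarrow> 'a" where "s i = (if i = 2 then 0 else x)" for i
    have s3: "s (2 + 1) = s 1"
      by (simp add: s_def)
    have "(\<Sum>i=1..2. blinfun_apply (B (s i)) (s (i + 1) - s i)) \<le> 0"
      using m[unfolded monotone_operator_def n_monotone_def, rule_format, of s "\<lambda>i. B (s i)"] s3
      by (simp add: op_graph_def)
    then show "blinfun_apply (B x) x \<ge> 0"
      using linear_0[OF assms] by (simp add: s_def numeral_2_eq_2 blinfun.minus_right)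
  qed
next
  assume p: "\<forall>x. blinfun_apply (B x) x \<ge> 0"
  show "monotone_operator B"
    unfolding monotone_operator_def n_monotone_def
  proof (intro allI impI)
    fix s :: "nat \<Rightarrow> 'a" and s' :: "nat \<Rightarrow> 'a dual"
    assume a: "(\<forall>i\<in>{1..2}. (s i, s' i) \<in> op_graph (\<lambda>x. {B x})) \<and> s (2 + 1) = s 1"
    have "blinfun_apply (B (s 1 - s 2)) (s 1 - s 2) \<ge> 0"
      using p by blast
    then show "(\<Sum>i=1..2. blinfun_apply (s' i) (s (i + 1) - s i)) \<le> 0"
      using a by (simp add: op_graph_def numeral_2_eq_2 numeral_3_eq_3 linear_diff[OF assms]
          blinfun.diff_left blinfun.diff_right)
  qed
qed

definition fitzpatrick ::
  "('a::real_normed_vector \<Rightarrow> 'a dual set) \<Rightarrow> nat \<Rightarrow> 'a \<times> 'a dual \<Rightarrow> ereal" where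
  "fitzpatrick S n = (\<lambda>(x, x').
     Sup {ereal ((\<Sum>i=1..n-2. blinfun_apply (s' i) (s (i + 1) - s i))
                 + blinfun_apply (s' (n - 1)) (x - s (n - 1))
                 + blinfun_apply x' (s 1)) | s s'.
          \<forall>i\<in>{1..n-1}. (s i, s' i) \<in> op_graph S})"

text \<open>The dual of \<open>X \<times> X*\<close> is \<open>X* \<times> X**\<close>; the second factor is identified with \<open>X\<close>, which is
  legitimate for reflexive \<open>X\<close>. Since the coupling terms are real, the subtraction in the extended
  reals is never of the indeterminate form.\<close>

definition fenchel_conjugate ::
  "('a::real_normed_vector \<times> 'a dual \<Rightarrow> ereal) \<Rightarrow> 'a dual \<times> 'a \<Rightarrow> ereal" where
  "fenchel_conjugate f = (\<lambda>(x', x).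
     SUP (y, y') \<in> UNIV. ereal (blinfun_apply x' y + blinfun_apply y' x) - f (y, y'))"

definition strongly_coercive :: "('a::real_normed_vector \<Rightarrow> 'a dual) \<Rightarrow> bool" where
  "strongly_coercive B \<longleftrightarrow>
     filterlim (\<lambda>x. blinfun_apply (B x) x / norm x) at_top at_infinity"

end

theory Submission
  imports Defs
begin

text \<open>The point \<open>(x, w' - B x)\<close> can be added to the graph iff
  \<open>F\<^bsub>S,n\<^esub>(x, w' - B x) \<le> \<langle>w' - B x, x\<rangle>\<close>. This is a system of inequalities in \<open>x\<close>, one for each affine
  function \<open>(y, y') \<mapsto> c + v' y + y' v\<close> in the supremum defining \<open>F\<^bsub>S,n\<^esub>\<close>; each is convex, continuous
  and coercive because of the term \<open>\<langle>B x, x\<rangle>\<close>. A convex combination of the inequalities belongs again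
  to a triple \<open>(c, v, v')\<close> and is solved by \<open>x = v\<close>, where it reads \<open>c + v' v \<le> 0\<close>; this holds since
  \<open>\<langle>v', v\<rangle> \<le> F\<^bsub>S,n\<^esub>\<^sup>*(v', v) \<le> - c\<close>. Hence every finite subsystem has a solution in the convex hull of the
  points \<open>v\<close> involved, which lie in the convex hull of the domain, and weak compactness of bounded
  closed convex sets yields a solution of the full system.\<close>

section \<open>Separation of a point from a closed convex set\<close>

definition sublinear :: "('a::real_vector \<Rightarrow> real) \<Rightarrow> bool" where
  "sublinear p \<longleftrightarrow> (\<forall>x y. p (x + y) \<le> p x + p y) \<and> (\<forall>t\<ge>0. \<forall>x. p (t *\<^sub>R x) = t * p x)"

lemma sublinear_add: "sublinear p \<Longrightarrow> p (x + y) \<le> p x + p y"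
  by (simp add: sublinear_def)

lemma sublinear_scaleR: "sublinear p \<Longrightarrow> t \<ge> 0 \<Longrightarrow> p (t *\<^sub>R x) = t * p x"
  by (simp add: sublinear_def)

lemma sublinear_0: "sublinear p \<Longrightarrow> p 0 = 0"
  using sublinear_scaleR[of p 0 0] by simp

lemma sublinear_minus: "sublinear p \<Longrightarrow> - p (- x) \<le> p x"
  using sublinear_add[of p x "- x"] by (simp add: sublinear_0)

lemma sublinearI:
  assumes add: "\<And>x y. p (x + y) \<le> p x + p y"
    and zero: "p 0 = 0"
    and scale: "\<And>t x. t > 0 \<Longrightarrow> p (t *\<^sub>R x) \<le> t * p x"
  shows "sublinear p"
proof -
  have "p (t *\<^sub>R x) = t * p x" if "t \<ge> 0" for t x
  proof (cases "t = 0")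
    case False
    with that have t: "t > 0" by simp
    have "p x \<le> inverse t * p (t *\<^sub>R x)"
      using scale[of "inverse t" "t *\<^sub>R x"] t by simp
    then have "t * p x \<le> p (t *\<^sub>R x)"
      using t by (simp add: field_simps)
    with scale[OF t] show ?thesis by (simp add: antisym)
  qed (simp add: zero)
  with add show ?thesis by (simp add: sublinear_def)
qed

lemma sublinear_norm: "sublinear norm"
  by (simp add: sublinear_def norm_triangle_ineq)

text \<open>The witness is the infimum of \<open>p (u + t d) - t * \<delta>\<close> over
  \<open>t \<ge> 0\<close> and \<open>d \<in> D\<close>: \<open>t = 0\<close> gives
  \<open>q \<le> p\<close>, and \<open>t = 1\<close> at \<open>u = - d\<close> gives the last bound.
  It serves both for separation, starting from the norm, and, with a singleton \<open>D\<close>, to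
  show that minimal sublinear functionals are odd.\<close>

lemma sublinear_shift:
  fixes p :: "'a::real_vector \<Rightarrow> real"
  assumes p: "sublinear p" and D: "convex D" "D \<noteq> {}" and pD: "\<And>d. d \<in> D \<Longrightarrow> \<delta> \<le> p d"
  shows "\<exists>q. sublinear q \<and> q \<le> p \<and> (\<forall>d\<in>D. q (- d) \<le> - \<delta>)"
proof -
  define A where "A u = {p (u + t *\<^sub>R d) - t * \<delta> | t d. t \<ge> 0 \<and> d \<in> D}" for u
  define q where "q u = Inf (A u)" for u
  have ne: "A u \<noteq> {}" for u
    using D(2) by (auto simp: A_def)
  \<comment> \<open>This is where \<open>\<delta> \<le> p d\<close> enters: it keeps the infimum
    finite.\<close>
  have low: "- p (- u) \<le> a" if "a \<in> A u" for u a
  proof -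
    from that obtain t d where td: "a = p (u + t *\<^sub>R d) - t * \<delta>" "t \<ge> 0" "d \<in> D"
      by (auto simp: A_def)
    have "t * \<delta> \<le> t * p d"
      using td pD by (simp add: mult_left_mono)
    also have "\<dots> = p ((u + t *\<^sub>R d) + (- u))"
      using sublinear_scaleR[OF p td(2)] by simp
    also have "\<dots> \<le> p (u + t *\<^sub>R d) + p (- u)"
      by (rule sublinear_add[OF p])
    finally show ?thesis using td(1) by simp
  qed
  have le: "q u \<le> a" if "a \<in> A u" for u a
    unfolding q_def using that low by (intro cInf_lower bdd_belowI)
  have ge: "b \<le> q u" if "\<And>a. a \<in> A u \<Longrightarrow> b \<le> a" for u b
    unfolding q_def using that ne by (intro cInf_greatest)
  have AI: "p (u + t *\<^sub>R d) - t * \<delta> \<in> A u" if "t \<ge> 0" "d \<in> D" for u t d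
    using that by (auto simp: A_def)
  obtain d0 where d0: "d0 \<in> D" using D(2) by blast
  have qp: "q u \<le> p u" for u
    using le[OF AI[of 0 d0 u]] d0 by simp
  have "sublinear q"
  proof (rule sublinearI)
    fix x y
    have sum: "q (x + y) \<le> a + b" if a: "a \<in> A x" and b: "b \<in> A y" for a b
    proof -
      obtain s d where sd: "a = p (x + s *\<^sub>R d) - s * \<delta>" "s \<ge> 0" "d \<in> D"
        using a by (auto simp: A_def)
      obtain t e where te: "b = p (y + t *\<^sub>R e) - t * \<delta>" "t \<ge> 0" "e \<in> D"
        using b by (auto simp: A_def)
      \<comment> \<open>Convexity of \<open>D\<close> merges the two shifts into one, so
        \<open>a + b\<close> dominates a member of \<open>A (x + y)\<close>.\<close>
      obtain f where f: "f \<in> D" "s *\<^sub>R d + t *\<^sub>R e = (s + t) *\<^sub>R f"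
      proof (cases "s + t = 0")
        case True
        with sd te have "s = 0" "t = 0" by auto
        with d0 that show ?thesis by auto
      next
        case False
        with sd te have st: "s + t > 0" by linarith
        let ?f = "(s / (s + t)) *\<^sub>R d + (t / (s + t)) *\<^sub>R e"
        have "?f \<in> D"
          using D(1) sd te st
          by (intro convexD) (auto simp: add_divide_distrib[symmetric])
        moreover have "s *\<^sub>R d + t *\<^sub>R e = (s + t) *\<^sub>R ?f"
          using st by (simp add: scaleR_right_distrib)
        ultimately show ?thesis using that by blast
      qed
      have "q (x + y) \<le> p (x + y + (s + t) *\<^sub>R f) - (s + t) * \<delta>"
        using sd te f by (intro le AI) auto
      also have "x + y + (s + t) *\<^sub>R f = (x + s *\<^sub>R d) + (y + t *\<^sub>R e)"
        using f(2) by (simp add: algebra_simps)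
      also have "p \<dots> \<le> p (x + s *\<^sub>R d) + p (y + t *\<^sub>R e)"
        by (rule sublinear_add[OF p])
      finally show ?thesis
        using sd te by (simp add: algebra_simps)
    qed
    have "q (x + y) - a \<le> q y" if "a \<in> A x" for a
      using sum[OF that] by (intro ge) (simp add: algebra_simps)
    then have "q (x + y) - q y \<le> q x"
      by (intro ge) (simp add: algebra_simps)
    then show "q (x + y) \<le> q x + q y" by simp
  next
    have "- p (- 0) \<le> q 0" by (intro ge low)
    with qp[of 0] show "q 0 = 0" by (simp add: sublinear_0[OF p])
  next
    fix t :: real and x
    assume t: "t > 0"
    have "q (t *\<^sub>R x) / t \<le> q x"
    proof (rule ge)
      fix a assume "a \<in> A x"
      then obtain s d where sd: "a = p (x + s *\<^sub>R d) - s * \<delta>" "s \<ge> 0" "d \<in> D"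
        by (auto simp: A_def)
      have "q (t *\<^sub>R x) \<le> p (t *\<^sub>R x + (t * s) *\<^sub>R d) - (t * s) * \<delta>"
        using sd t by (intro le AI) auto
      also have "t *\<^sub>R x + (t * s) *\<^sub>R d = t *\<^sub>R (x + s *\<^sub>R d)"
        by (simp add: algebra_simps)
      also have "p \<dots> - (t * s) * \<delta> = t * a"
        using sublinear_scaleR[OF p, of t "x + s *\<^sub>R d"] t sd(1) by (simp add: right_diff_distrib)
      finally show "q (t *\<^sub>R x) / t \<le> a"
        using t by (simp add: field_simps)
    qed
    then show "q (t *\<^sub>R x) \<le> t * q x"
      using t by (simp add: field_simps)
  qed
  moreover have "q (- d) \<le> - \<delta>" if "d \<in> D" for d
    using le[OF AI[of 1 d "- d"]] that by (simp add: sublinear_0[OF p])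
  ultimately show ?thesis using qp by (auto simp: le_fun_def)
qed

text \<open>Zorn's lemma applies because the pointwise infimum of a nonempty chain below
  \<open>p\<close> is finite, being at least \<open>- p (- x)\<close> at \<open>x\<close>, and again
  sublinear.\<close>

lemma minimal_sublinear_exists:
  fixes p :: "'a::real_vector \<Rightarrow> real"
  assumes p: "sublinear p"
  shows "\<exists>q. sublinear q \<and> q \<le> p \<and> (\<forall>r. sublinear r \<longrightarrow> r \<le> q \<longrightarrow> r = q)"
proof -
  let ?A = "{q. sublinear q \<and> q \<le> p}"
  have "\<exists>m\<in>?A. \<forall>a\<in>?A. a \<le> m \<longrightarrow> a = m"
  \<comment> \<open>The order is reversed, so maximal elements for Zorn's lemma are minimal
    functionals.\<close>
  proof (rule predicate_Zorn)
    show "partial_order_on ?A (relation_of (\<lambda>a b. b \<le> a) ?A)"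
      by (rule partial_order_on_relation_ofI) auto
  next
    fix C assume C: "C \<in> Chains (relation_of (\<lambda>a b. b \<le> a) ?A)"
    have CA: "C \<subseteq> ?A"
      using C by (auto simp: Chains_def relation_of_def)
    have tot: "a \<le> b \<or> b \<le> a" if "a \<in> C" "b \<in> C" for a b
      using C that by (auto simp: Chains_def relation_of_def)
    show "\<exists>u\<in>?A. \<forall>a\<in>C. u \<le> a"
    proof (cases "C = {}")
      case True
      then show ?thesis using p by auto
    next
      case False
      define u where "u x = (INF q\<in>C. q x)" for x
      have bdd: "bdd_below ((\<lambda>q. q x) ` C)" for x
      proof (rule bdd_belowI2)
        fix q assume "q \<in> C"
        then have "sublinear q" "q \<le> p" using CA by auto
        then show "- p (- x) \<le> q x"
          using sublinear_minus[of q x] le_funD[of q p "- x"] by linarith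
      qed
      have le: "u x \<le> q x" if "q \<in> C" for q x
        unfolding u_def using bdd that by (rule cINF_lower)
      have ge: "b \<le> u x" if "\<And>q. q \<in> C \<Longrightarrow> b \<le> q x" for b x
        unfolding u_def using False that by (rule cINF_greatest)
      have "sublinear u"
      proof (rule sublinearI)
        fix x y
        have sum: "u (x + y) \<le> a x + b y" if ab: "a \<in> C" "b \<in> C" for a b
        proof -
          obtain c where c: "c \<in> C" "c \<le> a" "c \<le> b"
            using tot[OF ab] ab by blast
          have "u (x + y) \<le> c (x + y)" by (rule le[OF c(1)])
          also have "\<dots> \<le> c x + c y"
            using CA c(1) by (intro sublinear_add) auto
          also have "\<dots> \<le> a x + b y"
            using c by (intro add_mono) (auto simp: le_fun_def)
          finally show ?thesis .
        qed
        have "u (x + y) - a x \<le> u y" if "a \<in> C" for a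
          using sum[OF that] by (intro ge) (simp add: algebra_simps)
        then have "u (x + y) - u y \<le> u x"
          by (intro ge) (simp add: algebra_simps)
        then show "u (x + y) \<le> u x + u y" by simp
      next
        have "q 0 = 0" if "q \<in> C" for q
          using CA that by (intro sublinear_0) auto
        then have "u 0 = (INF q\<in>C. 0)"
          unfolding u_def by (intro INF_cong) auto
        then show "u 0 = 0" using False by simp
      next
        fix t :: real and x
        assume t: "t > 0"
        have "u (t *\<^sub>R x) / t \<le> u x"
        proof (rule ge)
          fix q assume q: "q \<in> C"
          then have "u (t *\<^sub>R x) \<le> t * q x"
            using le[OF q, of "t *\<^sub>R x"] CA t by (auto simp: sublinear_scaleR)
          then show "u (t *\<^sub>R x) / t \<le> q x"
            using t by (simp add: field_simps)
        qed
        then show "u (t *\<^sub>R x) \<le> t * u x"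
          using t by (simp add: field_simps)
      qed
      moreover obtain q where q: "q \<in> C" using False by blast
      then have "u \<le> q" using le by (simp add: le_fun_def)
      then have "u \<le> p" using q CA by (blast intro: order_trans)
      ultimately show ?thesis
        using le by (auto simp: le_fun_def)
    qed
  qed
  then obtain q where q: "q \<in> ?A" "\<forall>r\<in>?A. r \<le> q \<longrightarrow> r = q" by blast
  have "r = q" if "sublinear r" "r \<le> q" for r
    using q order_trans[OF that(2), of p] that by simp
  with q(1) show ?thesis by blast
qed

text \<open>Shifting \<open>q\<close> along \<open>{v}\<close> with \<open>\<delta> = q v\<close>
  gives a sublinear minorant whose value at \<open>- v\<close> is at most \<open>- q v\<close>; by
  minimality it is \<open>q\<close> itself, so \<open>q\<close> is odd. An odd sublinear functional
  is also superadditive, hence linear.\<close>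

lemma minimal_sublinear_linear:
  fixes q :: "'a::real_vector \<Rightarrow> real"
  assumes q: "sublinear q" and min: "\<And>r. sublinear r \<Longrightarrow> r \<le> q \<Longrightarrow> r = q"
  shows "linear q"
proof -
  have neg: "q (- v) = - q v" for v
  proof -
    obtain r where "sublinear r" "r \<le> q" "r (- v) \<le> - q v"
      using sublinear_shift[OF q, of "{v}" "q v"] by auto
    with min have "q (- v) \<le> - q v" by blast
    with sublinear_minus[OF q, of v] show ?thesis by simp
  qed
  show ?thesis
  proof (rule linearI)
    fix x y
    have "- q (x + y) \<le> - q x + - q y"
      using sublinear_add[OF q, of "- x" "- y"] by (simp only: neg minus_add_distrib[symmetric])
    with sublinear_add[OF q, of x y] show "q (x + y) = q x + q y" by simp
  next
    fix t :: real and x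
    show "q (t *\<^sub>R x) = t *\<^sub>R q x"
    proof (cases "t \<ge> 0")
      case False
      then show ?thesis
        using sublinear_scaleR[OF q, of "- t" x] neg[of "t *\<^sub>R x"] by simp
    qed (simp add: sublinear_scaleR[OF q])
  qed
qed

text \<open>Hahn-Banach separation: the norm is shifted along \<open>C - x\<close> by the distance
  from \<open>x\<close> to \<open>C\<close>. A minimal sublinear functional below the result is
  linear, bounded by the norm, and on \<open>C\<close> exceeds its value at \<open>x\<close> by at
  least that distance.\<close>

lemma separate_point_closed_convex:
  fixes C :: "'a::real_normed_vector set"
  assumes "convex C" "closed C" "x \<notin> C"
  shows "\<exists>(f :: 'a dual) b. f x < b \<and> (\<forall>y\<in>C. b \<le> f y)"
proof (cases "C = {}")
  case True
  then show ?thesis by (intro exI[of _ 0] exI[of _ 1]) simp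
next
  case False
  define \<delta> where "\<delta> = infdist x C"
  have \<delta>: "\<delta> > 0"
    unfolding \<delta>_def using assms False by (intro infdist_pos_not_in_closed)
  define D where "D = (\<lambda>y. y - x) ` C"
  have "convex D" "D \<noteq> {}"
    using assms(1) False by (auto simp: D_def)
  moreover have "\<delta> \<le> norm d" if "d \<in> D" for d
    using that infdist_le[of _ C x] by (auto simp: D_def \<delta>_def dist_norm norm_minus_commute)
  ultimately obtain q where q: "sublinear q" "q \<le> norm" "\<forall>d\<in>D. q (- d) \<le> - \<delta>"
    using sublinear_shift[OF sublinear_norm] by blast
  obtain f where f: "sublinear f" "f \<le> q" "\<forall>r. sublinear r \<longrightarrow> r \<le> f \<longrightarrow> r = f"
    using minimal_sublinear_exists[OF q(1)] by blast
  have lin: "linear f"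
    using f(3) by (intro minimal_sublinear_linear[OF f(1)]) blast
  have fn: "f u \<le> norm u" for u
    using order_trans[OF f(2) q(2)] by (rule le_funD)
  have bl: "bounded_linear f"
  proof (rule bounded_linear_intro[where K = 1])
    fix u
    show "norm (f u) \<le> norm u * 1"
      using fn[of u] fn[of "- u"] by (simp add: linear_neg[OF lin] abs_le_iff)
  qed (simp_all add: linear_add[OF lin] linear_scale[OF lin])
  have "f x + \<delta> \<le> f y" if "y \<in> C" for y
  proof -
    have "f (- (y - x)) \<le> - \<delta>"
      using le_funD[OF f(2), of "- (y - x)"] q(3) that by (fastforce simp: D_def)
    then show ?thesis by (simp add: linear_diff[OF lin])
  qed
  then have "blinfun_apply (Blinfun f) x < f x + \<delta> \<and> (\<forall>y\<in>C. f x + \<delta> \<le> blinfun_apply (Blinfun f) y)"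
    unfolding bounded_linear_Blinfun_apply[OF bl] using \<delta> by simp
  then show ?thesis by (intro exI)
qed

section \<open>Compactness of bounded closed convex sets in reflexive spaces\<close>

text \<open>This stands in for weak compactness. Points are embedded as evaluations into a product
  of real lines indexed by the dual, where the box \<open>K\<close> is compact by Tychonoff. A point
  common to all closures is a bounded linear functional, which reflexivity represents by a point of
  the space; separation places that point in every \<open>E i\<close>.\<close>

lemma reflexive_closed_convex_fip:
  fixes E :: "'i \<Rightarrow> 'a::real_normed_vector set"
  assumes refl: "reflexive_space TYPE('a)"
    and E: "\<And>i. i \<in> I \<Longrightarrow> convex (E i)" "\<And>i. i \<in> I \<Longrightarrow> closed (E i)"
    and i0: "i0 \<in> I" "bounded (E i0)"
    and fip: "\<And>J. finite J \<Longrightarrow> J \<subseteq> I \<Longrightarrow> (\<Inter>i\<in>J. E i) \<noteq> {}"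
  shows "(\<Inter>i\<in>I. E i) \<noteq> {}"
proof -
  obtain R where R: "\<And>x. x \<in> E i0 \<Longrightarrow> norm x \<le> R"
    using i0(2) by (auto simp: bounded_iff)
  define ev where "ev x = (\<lambda>f :: 'a dual. blinfun_apply f x)" for x
  define K :: "('a dual \<Rightarrow> real) set" where "K = (\<Pi>\<^sub>E f\<in>UNIV. {- (norm f * R) .. norm f * R})"
  define Z where "Z i = closure (ev ` (E i \<inter> E i0))" for i
  have "compactin (product_topology (\<lambda>_. euclidean) UNIV) K"
    unfolding K_def compactin_PiE by auto
  then have "compact K"
    by (simp add: euclidean_product_topology)
  then have "K \<inter> (\<Inter>i\<in>I. Z i) \<noteq> {}"
  proof (rule compact_imp_fip_image)
    fix J assume J: "finite J" "J \<subseteq> I"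
    then have "(\<Inter>i\<in>insert i0 J. E i) \<noteq> {}"
      using i0 by (intro fip) auto
    then obtain x where x: "x \<in> E i0" "\<And>i. i \<in> J \<Longrightarrow> x \<in> E i" by auto
    have "\<bar>blinfun_apply f x\<bar> \<le> norm f * R" for f :: "'a dual"
      using norm_blinfun[of f x] mult_left_mono[OF R[OF x(1)], of "norm f"] by simp
    then have "ev x \<in> K"
      by (auto simp: ev_def K_def abs_le_iff minus_le_iff)
    moreover have "ev x \<in> Z i" if "i \<in> J" for i
      unfolding Z_def using x that by (intro subsetD[OF closure_subset]) auto
    ultimately show "K \<inter> (\<Inter>i\<in>J. Z i) \<noteq> {}" by blast
  qed (simp add: Z_def)
  then obtain \<phi> where \<phi>: "\<phi> \<in> K" "\<And>i. i \<in> I \<Longrightarrow> \<phi> \<in> Z i" by auto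
  have coord: "continuous_on UNIV (\<lambda>\<psi> :: 'a dual \<Rightarrow> real. \<psi> f)" for f
    by simp
  \<comment> \<open>Closed conditions on finitely many coordinates pass from evaluations to
    \<open>\<phi>\<close>; this covers additivity, homogeneity and half-spaces.\<close>
  have closedI: "\<phi> \<in> W" if "i \<in> I" "closed W" "\<And>x. x \<in> E i \<Longrightarrow> ev x \<in> W" for i W
    using \<phi>(2)[OF that(1)] closure_minimal[of "ev ` (E i \<inter> E i0)" W] that by (auto simp: Z_def)
  have "bounded_linear \<phi>"
  proof (rule bounded_linear_intro[where K = R])
    fix f g
    have "\<phi> \<in> {\<psi>. \<psi> (f + g) = \<psi> f + \<psi> g}"
      by (intro closedI[OF i0(1)] closed_Collect_eq continuous_on_add continuous_on_scaleR continuous_on_const coord)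
        (simp add: ev_def blinfun.add_left)
    then show "\<phi> (f + g) = \<phi> f + \<phi> g" by simp
  next
    fix t f
    have "\<phi> \<in> {\<psi>. \<psi> (t *\<^sub>R f) = t *\<^sub>R \<psi> f}"
      by (intro closedI[OF i0(1)] closed_Collect_eq continuous_on_add continuous_on_scaleR continuous_on_const coord)
        (simp add: ev_def blinfun.scaleR_left)
    then show "\<phi> (t *\<^sub>R f) = t *\<^sub>R \<phi> f" by simp
  next
    fix f
    have "\<phi> f \<in> {- (norm f * R) .. norm f * R}"
      using \<phi>(1) unfolding K_def by (auto simp: PiE_iff)
    then show "norm (\<phi> f) \<le> norm f * R" by (auto simp: abs_le_iff)
  qed
  then obtain x where x: "\<And>f. \<phi> f = blinfun_apply f x"
    using refl unfolding reflexive_space_def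
    by (metis bounded_linear_Blinfun_apply)
  have "x \<in> E i" if i: "i \<in> I" for i
  proof (rule ccontr)
    assume "x \<notin> E i"
    then obtain f :: "'a dual" and b where fb: "blinfun_apply f x < b" "\<forall>y\<in>E i. b \<le> blinfun_apply f y"
      using separate_point_closed_convex[OF E(1)[OF i] E(2)[OF i]] by blast
    have "\<phi> \<in> {\<psi>. b \<le> \<psi> f}"
      using fb(2) by (intro closedI[OF i] closed_Collect_le continuous_on_const coord) (simp add: ev_def)
    with fb(1) x show False by simp
  qed
  then show ?thesis by blast
qed

section \<open>Systems of convex inequalities\<close>

text \<open>A minimiser of the sum of squares of the positive parts is a solution: otherwise these
  positive parts serve as multipliers \<open>\<mu>\<close>, and moving towards the point \<open>y\<close> that solves the
  \<open>\<mu>\<close>-combination decreases the sum to first order.\<close>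

lemma convex_system_solvable:
  fixes a :: "'i \<Rightarrow> 'a::real_normed_vector \<Rightarrow> real"
  assumes fin: "finite T" and K: "compact K" "K \<noteq> {}"
    and cont: "\<And>t. t \<in> T \<Longrightarrow> continuous_on K (a t)"
    and conv: "\<And>t. t \<in> T \<Longrightarrow> convex_on K (a t)"
    and comb: "\<And>\<mu>. (\<And>t. t \<in> T \<Longrightarrow> \<mu> t \<ge> 0) \<Longrightarrow> sum \<mu> T > 0 \<Longrightarrow> \<exists>y\<in>K. (\<Sum>t\<in>T. \<mu> t * a t y) \<le> 0"
  shows "\<exists>x\<in>K. \<forall>t\<in>T. a t x \<le> 0"
proof -
  define g where "g x = (\<Sum>t\<in>T. (max 0 (a t x))\<^sup>2)" for x
  have "continuous_on K g"
    unfolding g_def by (intro continuous_intros cont)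
  then obtain x where x: "x \<in> K" "\<And>z. z \<in> K \<Longrightarrow> g x \<le> g z"
    using continuous_attains_inf[OF K] by blast
  define \<mu> where "\<mu> t = max 0 (a t x)" for t
  have gx: "g x = (\<Sum>t\<in>T. (\<mu> t)\<^sup>2)"
    by (simp add: g_def \<mu>_def)
  have "\<mu> t = 0" if "t \<in> T" for t
  proof (rule ccontr)
    assume "\<mu> t \<noteq> 0"
    then have \<mu>t: "\<mu> t > 0" by (simp add: \<mu>_def)
    then have "sum \<mu> T > 0"
      using fin that by (intro sum_pos2[of _ t]) (auto simp: \<mu>_def)
    with comb[of \<mu>] obtain y where y: "y \<in> K" "(\<Sum>t\<in>T. \<mu> t * a t y) \<le> 0"
      by (auto simp: \<mu>_def)
    define d where "d t = a t y - a t x" for t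
    define D where "D = (\<Sum>t\<in>T. (d t)\<^sup>2)"
    \<comment> \<open>Wherever \<open>\<mu> t\<close> is nonzero it equals \<open>a t x\<close>, so
      each product is a square.\<close>
    have "(\<Sum>t\<in>T. \<mu> t * a t x) = g x"
      unfolding gx by (intro sum.cong) (auto simp: \<mu>_def max_def power2_eq_square)
    then have \<mu>d: "(\<Sum>t\<in>T. \<mu> t * d t) \<le> - g x"
      using y(2) by (simp add: d_def right_diff_distrib sum_subtractf)
    \<comment> \<open>Minimality of \<open>g\<close> at \<open>x\<close> is tested on the segment
      towards \<open>y\<close> and divided by \<open>\<tau>\<close>: the first-order term is at most
      \<open>- 2 * g x\<close>, and \<open>D\<close> bounds the quadratic remainder.\<close>
    have step: "2 * g x \<le> \<tau> * D" if \<tau>: "0 < \<tau>" "\<tau> \<le> 1" for \<tau>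
    proof -
      define z where "z = (1 - \<tau>) *\<^sub>R x + \<tau> *\<^sub>R y"
      have convK: "convex K"
        using conv[OF \<open>t \<in> T\<close>] by (simp add: convex_on_def)
      have "z \<in> K"
        unfolding z_def using convK x(1) y(1) \<tau> by (intro convexD) auto
      then have "g x \<le> g z" by (rule x(2))
      also have "\<dots> \<le> (\<Sum>t\<in>T. (\<mu> t + \<tau> * d t)\<^sup>2)"
        unfolding g_def
      proof (rule sum_mono)
        fix t assume t: "t \<in> T"
        have "a t z \<le> (1 - \<tau>) * a t x + \<tau> * a t y"
          unfolding z_def using conv[OF t] x(1) y(1) \<tau> by (intro convex_onD) auto
        also have "\<dots> = a t x + \<tau> * d t"
          by (simp add: d_def algebra_simps)
        also have "\<dots> \<le> \<mu> t + \<tau> * d t"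
          by (simp add: \<mu>_def)
        finally have le: "a t z \<le> \<mu> t + \<tau> * d t" .
        show "(max 0 (a t z))\<^sup>2 \<le> (\<mu> t + \<tau> * d t)\<^sup>2"
        proof (cases "a t z \<le> 0")
          case False
          with le show ?thesis by (intro power_mono) auto
        qed simp
      qed
      also have "\<dots> = g x + 2 * \<tau> * (\<Sum>t\<in>T. \<mu> t * d t) + \<tau>\<^sup>2 * D"
        unfolding gx D_def sum_distrib_left sum.distrib[symmetric]
        by (intro sum.cong) (auto simp: power2_eq_square algebra_simps)
      also have "\<dots> \<le> g x - 2 * \<tau> * g x + \<tau>\<^sup>2 * D"
        using mult_left_mono[OF \<mu>d, of "2 * \<tau>"] \<tau> by simp
      finally have "\<tau> * (2 * g x) \<le> \<tau> * (\<tau> * D)"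
        by (simp add: power2_eq_square algebra_simps)
      then show ?thesis using \<tau> by simp
    qed
    have gpos: "g x > 0"
      unfolding gx using fin that \<mu>t by (intro sum_pos2[of _ t]) auto
    have "D \<ge> 0" by (simp add: D_def sum_nonneg)
    \<comment> \<open>This choice forces \<open>\<tau> * D \<le> g x\<close>, against
      \<open>step\<close>; the \<open>+ 1\<close> avoids division by zero.\<close>
    define \<tau> where "\<tau> = min 1 (g x / (D + 1))"
    have \<tau>: "0 < \<tau>" "\<tau> \<le> 1" "\<tau> \<le> g x / (D + 1)"
      using gpos \<open>D \<ge> 0\<close> by (auto simp: \<tau>_def)
    have "\<tau> * D \<le> \<tau> * (D + 1)" using \<tau> by simp
    also have "\<dots> \<le> g x"
      using \<tau>(3) \<open>D \<ge> 0\<close> by (simp add: pos_le_divide_eq)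
    finally show False using step[OF \<tau>(1,2)] gpos by simp
  qed
  then have "a t x \<le> 0" if "t \<in> T" for t
    using that max.cobounded2[of "a t x" 0] by (simp add: \<mu>_def)
  then show ?thesis
    using x(1) by blast
qed

text \<open>Rescaling \<open>x\<close> to norm \<open>\<delta> / 2\<close> spreads the bound near 0
  to the whole space. The constant later controls the cross term \<open>B x v\<close> in the
  coercivity estimate.\<close>

lemma linear_continuous_at_0_bound:
  fixes B :: "'a::real_normed_vector \<Rightarrow> 'b::real_normed_vector"
  assumes lin: "linear B" and cont: "isCont B 0"
  shows "\<exists>M\<ge>0. \<forall>x. norm (B x) \<le> M * norm x"
proof -
  obtain \<delta> where \<delta>: "\<delta> > 0" "\<And>x. norm x < \<delta> \<Longrightarrow> norm (B x) < 1"
    using cont unfolding continuous_at_eps_delta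
    by (metis diff_zero dist_norm linear_0[OF lin] zero_less_one)
  have "norm (B x) \<le> 2 / \<delta> * norm x" for x
  proof (cases "x = 0")
    case False
    define r where "r = \<delta> / (2 * norm x)"
    have r: "r > 0" using False \<delta> by (simp add: r_def)
    have "norm (r *\<^sub>R x) < \<delta>"
      using False \<delta> by (simp add: r_def)
    then have "r * norm (B x) < 1"
      using \<delta>(2)[of "r *\<^sub>R x"] r by (simp add: linear_scale[OF lin])
    then show ?thesis
      using False \<delta> by (simp add: r_def field_simps)
  qed (simp add: linear_0[OF lin])
  then show ?thesis using \<delta> by (intro exI[of _ "2 / \<delta>"]) auto
qed

text \<open>A triple \<open>(c, v, v')\<close> encodes the affine function \<open>(y, y') \<mapsto> c + v' y + y' v\<close> on the product
  of the space and its dual.\<close>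

lemma coercive_system_solvable:
  fixes B :: "'a::real_normed_vector \<Rightarrow> 'a dual" and T :: "(real \<times> 'a \<times> 'a dual) set"
  assumes refl: "reflexive_space TYPE('a)"
    and lin: "linear B" and cont: "continuous_on UNIV B"
    and mono: "\<And>x. B x x \<ge> 0" and coer: "strongly_coercive B"
    and "T \<noteq> {}"
    and comb: "\<And>c v v'. (c, v, v') \<in> convex hull T \<Longrightarrow> c + blinfun_apply v' v \<le> 0"
  shows "\<exists>x \<in> closure (convex hull ((fst \<circ> snd) ` T)).
           \<forall>(c, v, v') \<in> T. c + blinfun_apply v' x + (w - B x) (v - x) \<le> 0"
proof -
  define C where "C = closure (convex hull ((fst \<circ> snd) ` T))"
  define a where "a t x = fst t + snd (snd t) x + (w - B x) (fst (snd t) - x)"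
    for t :: "real \<times> 'a \<times> 'a dual" and x
  define E where "E t = C \<inter> {x. a t x \<le> 0}" for t
  have cont_a: "continuous_on A (a t)" for t A
    unfolding a_def
    by (intro continuous_intros continuous_on_subset[OF cont]) auto
  have conv_a: "convex_on A (a t)" if "convex A" for t A
  proof (rule convex_onI[OF _ that])
    fix s x y
    assume s: "0 < (s::real)" "s < 1"
    \<comment> \<open>Apart from \<open>B x x\<close>, all terms of \<open>a t x\<close> are affine
      in \<open>x\<close> and cancel, leaving the convexity defect of the quadratic form.\<close>
    have "(1 - s) * a t x + s * a t y - a t ((1 - s) *\<^sub>R x + s *\<^sub>R y) = s * (1 - s) * B (x - y) (x - y)"
      unfolding a_def
      by (simp add: linear_add[OF lin] linear_diff[OF lin] linear_scale[OF lin]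
          blinfun.bilinear_simps algebra_simps)
    also have "\<dots> \<ge> 0" using s mono by simp
    finally show "a t ((1 - s) *\<^sub>R x + s *\<^sub>R y) \<le> (1 - s) * a t x + s * a t y" by simp
  qed
  obtain t0 where t0: "t0 \<in> T" using \<open>T \<noteq> {}\<close> by blast
  have "(\<Inter>t\<in>T. E t) \<noteq> {}"
  proof (rule reflexive_closed_convex_fip[OF refl _ _ t0])
    fix t
    have "convex {x. a t x \<le> 0}"
    proof (rule convexI, clarify)
      fix x y and r s :: real
      assume le: "a t x \<le> 0" "a t y \<le> 0" and rs: "0 \<le> r" "0 \<le> s" "r + s = 1"
      have "a t (r *\<^sub>R x + s *\<^sub>R y) \<le> r * a t x + s * a t y"
        using conv_a[OF convex_UNIV, of t] rs unfolding convex_on_def by blast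
      also have "\<dots> \<le> 0"
        using le rs by (simp add: add_nonpos_nonpos mult_nonneg_nonpos)
      finally show "a t (r *\<^sub>R x + s *\<^sub>R y) \<le> 0" .
    qed
    then show "convex (E t)"
      unfolding E_def C_def by (intro convex_Int convex_closure convex_convex_hull)
    show "closed (E t)"
      unfolding E_def C_def by (intro closed_Int closed_closure closed_Collect_le cont_a continuous_on_const)
  next
    obtain M where M: "M \<ge> 0" "\<And>x. norm (B x) \<le> M * norm x"
      using linear_continuous_at_0_bound[OF lin] cont
      by (auto simp: continuous_on_eq_continuous_at)
    obtain c v v' where cv: "t0 = (c, v, v')" by (cases t0)
    \<comment> \<open>\<open>N - 1\<close> collects the coefficients of all terms other than
      \<open>B x x\<close>, the constants being absorbed since \<open>norm x > 1\<close>; the extra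
      1 makes the contradiction strict.\<close>
    define N where "N = norm v' + norm w + M * norm v + \<bar>c\<bar> + norm w * norm v + 1"
    obtain R where R: "\<And>x. R \<le> norm x \<Longrightarrow> N \<le> B x x / norm x"
      using coer unfolding strongly_coercive_def filterlim_at_top eventually_at_infinity by blast
    have "norm x \<le> max 1 R" if x: "x \<in> E t0" for x
    proof (rule ccontr)
      assume "\<not> norm x \<le> max 1 R"
      then have nx: "norm x > 1" "N \<le> B x x / norm x" using R by auto
      have b: "\<bar>v' x\<bar> \<le> norm v' * norm x" "\<bar>w x\<bar> \<le> norm w * norm x" "\<bar>w v\<bar> \<le> norm w * norm v"
        using norm_blinfun[of v' x] norm_blinfun[of w x] norm_blinfun[of w v] by auto
      have Bv: "\<bar>B x v\<bar> \<le> (M * norm v) * norm x"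
        using order_trans[OF norm_blinfun[of "B x" v] mult_right_mono[OF M(2) norm_ge_zero]]
        by (simp add: mult_ac)
      have "B x x \<le> - c - v' x - w v + w x + B x v"
        using x by (simp add: E_def a_def cv blinfun.bilinear_simps)
      also have "\<dots> \<le> norm v' * norm x + norm w * norm x + (M * norm v) * norm x + (\<bar>c\<bar> + norm w * norm v) * 1"
        using b Bv abs_ge_minus_self[of c] by (simp add: abs_le_iff)
      also have "\<dots> \<le> norm v' * norm x + norm w * norm x + (M * norm v) * norm x + (\<bar>c\<bar> + norm w * norm v) * norm x"
        using nx by (intro add_left_mono mult_left_mono) auto
      also have "\<dots> = (N - 1) * norm x"
        by (simp add: N_def algebra_simps)
      also have "\<dots> < N * norm x" using nx by (intro mult_strict_right_mono) auto
      also have "\<dots> \<le> B x x"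
        using nx(2) order_less_trans[OF zero_less_one nx(1)] by (simp only: pos_le_divide_eq)
      finally show False by simp
    qed
    then show "bounded (E t0)" by (auto simp: bounded_iff)
  next
    fix J assume J: "finite J" "J \<subseteq> T"
    show "(\<Inter>t\<in>J. E t) \<noteq> {}"
    proof (cases "J = {}")
      case False
      define K where "K = convex hull ((fst \<circ> snd) ` J)"
      have "\<exists>x\<in>K. \<forall>t\<in>J. a t x \<le> 0"
      proof (rule convex_system_solvable[OF J(1)])
        show "compact K"
          unfolding K_def using J by (intro finite_imp_compact_convex_hull) simp
        show "K \<noteq> {}" using False by (simp add: K_def)
        show "convex_on K (a t)" for t
          by (intro conv_a) (simp add: K_def)
      next
        fix \<mu> :: "real \<times> 'a \<times> 'a dual \<Rightarrow> real"
        assume \<mu>: "\<And>t. t \<in> J \<Longrightarrow> \<mu> t \<ge> 0" "sum \<mu> J > 0"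
        define m where "m = sum \<mu> J"
        \<comment> \<open>Normalised multipliers turn the system into one triple \<open>p\<close> in
          the hull; its point component \<open>y\<close> is the candidate solution.\<close>
        define p where "p = (\<Sum>t\<in>J. (\<mu> t / m) *\<^sub>R t)"
        have sum1: "(\<Sum>t\<in>J. \<mu> t / m) = 1"
          using \<mu>(2) by (simp add: m_def flip: sum_divide_distrib)
        have nn: "\<mu> t / m \<ge> 0" if "t \<in> J" for t
          using \<mu> that by (simp add: m_def)
        have pT: "p \<in> convex hull T"
          unfolding p_def using J sum1 nn
          by (intro convex_sum convex_convex_hull) (auto intro: hull_inc)
        define y where "y = fst (snd p)"
        have y: "y = (\<Sum>t\<in>J. (\<mu> t / m) *\<^sub>R fst (snd t))"
          by (simp add: y_def p_def fst_sum snd_sum)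
        have "y \<in> K"
          unfolding y K_def using J sum1 nn
          by (intro convex_sum convex_convex_hull) (auto intro: hull_inc)
        moreover have "(\<Sum>t\<in>J. \<mu> t * a t y) \<le> 0"
        proof -
          \<comment> \<open>For fixed \<open>y\<close>, \<open>a t y\<close> is the linear
            \<open>L t\<close> minus \<open>(w - B y) y\<close>. Averaging gives
            \<open>L p - (w - B y) y\<close>; as \<open>y\<close> is the point component of
            \<open>p\<close>, the terms with \<open>w - B y\<close> cancel and \<open>comb\<close>
            applies.\<close>
          define L where "L t = fst t + snd (snd t) y + (w - B y) (fst (snd t))" for t :: "real \<times> 'a \<times> 'a dual"
          have L: "linear L"
            by (rule linearI) (simp_all add: L_def blinfun.bilinear_simps algebra_simps)
          have "(\<Sum>t\<in>J. \<mu> t / m * a t y) = (\<Sum>t\<in>J. \<mu> t / m * L t) - (\<Sum>t\<in>J. \<mu> t / m) * (w - B y) y"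
            unfolding sum_distrib_right sum_subtractf[symmetric]
            by (intro sum.cong) (simp_all add: a_def L_def blinfun.diff_right algebra_simps)
          also have "(\<Sum>t\<in>J. \<mu> t / m * L t) = L p"
            unfolding p_def linear_sum[OF L] by (simp add: linear_scale[OF L])
          also have "L p - (\<Sum>t\<in>J. \<mu> t / m) * (w - B y) y = fst p + snd (snd p) y"
            using sum1 by (simp add: L_def y_def)
          also have "\<dots> \<le> 0"
            using comb[of "fst p" "fst (snd p)" "snd (snd p)"] pT by (simp add: y_def)
          finally have "(\<Sum>t\<in>J. \<mu> t * a t y) / m \<le> 0"
            by (simp add: sum_divide_distrib)
          then show ?thesis
            using \<mu>(2) by (simp add: m_def divide_le_0_iff)
        qed
        ultimately show "\<exists>y\<in>K. (\<Sum>t\<in>J. \<mu> t * a t y) \<le> 0" by blast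
      qed (rule cont_a)
      moreover have "K \<subseteq> C"
        unfolding K_def C_def using J(2)
        by (intro order_trans[OF hull_mono closure_subset] image_mono)
      ultimately show ?thesis by (auto simp: E_def)
    qed simp
  qed
  then obtain x where x: "\<And>t. t \<in> T \<Longrightarrow> x \<in> E t" by blast
  show ?thesis
  proof (intro bexI ballI)
    show "x \<in> closure (convex hull ((fst \<circ> snd) ` T))"
      using x[OF t0] by (simp add: E_def C_def)
    fix t assume "t \<in> T"
    then show "case t of (c, v, v') \<Rightarrow> c + blinfun_apply v' x + (w - B x) (v - x) \<le> 0"
      using x[of t] by (auto simp: E_def a_def split: prod.split)
  qed
qed

section \<open>Chains in a graph\<close>

text \<open>A list is read as a path of graph points followed by the endpoint \<open>y\<close>; the
  empty path starts at its end.\<close>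

fun chain_start :: "('a \<times> 'b) list \<Rightarrow> 'a \<Rightarrow> 'a" where
  "chain_start [] y = y"
| "chain_start (p # xs) y = fst p"

text \<open>This is the expression in the supremum of \<open>fitzpatrick\<close> without the term
  pairing the dual argument with the first point.\<close>

fun chain_sum :: "('a::real_normed_vector \<times> 'a dual) list \<Rightarrow> 'a \<Rightarrow> real" where
  "chain_sum [] y = 0"
| "chain_sum (p # xs) y = snd p (chain_start xs y - fst p) + chain_sum xs y"

lemma chain_start_nonempty: "xs \<noteq> [] \<Longrightarrow> chain_start xs y = chain_start xs z"
  by (cases xs) auto

lemma chain_start_in: "xs \<noteq> [] \<Longrightarrow> chain_start xs y \<in> fst ` set xs"
  by (cases xs) auto

lemma chain_start_append: "chain_start (xs @ ys) y = chain_start xs (chain_start ys y)"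
  by (cases xs) auto

lemma chain_sum_append: "chain_sum (xs @ ys) y = chain_sum xs (chain_start ys y) + chain_sum ys y"
  by (induction xs) (auto simp: chain_start_append)

lemma chain_start_pad: "chain_start (replicate j p @ p # xs) y = fst p"
  by (cases j) auto

text \<open>Repeating a point adds zero increments, so short chains can be lengthened at
  will.\<close>

lemma chain_sum_pad: "chain_sum (replicate j p @ p # xs) y = chain_sum (p # xs) y"
  by (induction j) (auto simp: chain_start_pad blinfun.zero_right)

text \<open>Only the last increment involves the endpoint. This is how a chain yields a
  triple.\<close>

lemma chain_sum_affine:
  "xs \<noteq> [] \<Longrightarrow> chain_sum xs y = chain_sum xs 0 + snd (last xs) y"
proof (induction xs)
  case (Cons p xs)
  then show ?case
    using chain_start_nonempty[of xs y 0] by (cases "xs = []") (auto simp: blinfun.bilinear_simps)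
qed simp

lemma chain_start_map_upt:
  "m \<le> n \<Longrightarrow> chain_start (map (\<lambda>i. (s i, s' i)) [m..<n]) (s n) = s m"
  by (cases "m = n") (auto simp: upt_conv_Cons)

lemma chain_sum_map_upt:
  assumes "m \<le> n"
  shows "chain_sum (map (\<lambda>i. (s i, s' i)) [m..<n]) (s n) = (\<Sum>i=m..<n. s' i (s (i + 1) - s i))"
  using assms
proof (induction n rule: dec_induct)
  case (step n)
  then show ?case by (simp add: chain_sum_append)
qed simp

text \<open>The left side is the sum over the cycle from \<open>x\<close> through \<open>xs\<close>
  back to \<open>x\<close>. A visit to \<open>(x, x')\<close> splits it into two shorter cycles of
  the same kind; an empty piece contributes \<open>x' (x - x) = 0\<close>, and pieces inside
  \<open>G\<close> are covered by assumption.\<close>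

lemma chain_sum_insert_le:
  assumes G: "\<And>xs. set xs \<subseteq> G \<Longrightarrow> length xs \<le> k \<Longrightarrow> xs \<noteq> [] \<Longrightarrow>
      chain_sum xs x + blinfun_apply x' (chain_start xs x - x) \<le> 0"
    and "set xs \<subseteq> insert (x, x') G" "length xs \<le> k"
  shows "chain_sum xs x + blinfun_apply x' (chain_start xs x - x) \<le> 0"
  using assms(2,3)
proof (induction xs rule: length_induct)
  case (1 xs)
  show ?case
  proof (cases "(x, x') \<in> set xs")
    case True
    then obtain ys zs where xs: "xs = ys @ (x, x') # zs"
      by (auto simp: in_set_conv_decomp)
    then have "chain_sum ys x + x' (chain_start ys x - x) \<le> 0"
      "chain_sum zs x + x' (chain_start zs x - x) \<le> 0"
      using 1 by auto
    then show ?thesis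
      by (simp add: xs chain_sum_append chain_start_append)
  next
    case False
    then have "set xs \<subseteq> G" using 1 by auto
    then show ?thesis
      using 1 G[of xs] by (cases "xs = []") (auto simp: blinfun.zero_right)
  qed
qed

text \<open>A cycle through \<open>(x, x')\<close> is rotated to start there and then cut at the remaining visits to
  \<open>(x, x')\<close>; each piece is padded to \<open>n - 1\<close> points of \<open>G\<close> by repeating its first point.\<close>

lemma n_monotone_insert:
  assumes mono: "n_monotone n G"
    and G: "\<And>xs. set xs \<subseteq> G \<Longrightarrow> length xs = n - 1 \<Longrightarrow>
      chain_sum xs x + blinfun_apply x' (chain_start xs x - x) \<le> 0"
  shows "n_monotone n (insert (x, x') G)"
  unfolding n_monotone_def
proof (intro allI impI, elim conjE)
  fix s s'
  assume s: "\<forall>i\<in>{1..n}. (s i, s' i) \<in> insert (x, x') G" "s (n + 1) = s 1"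
  define xs where "xs = map (\<lambda>i. (s i, s' i)) [1..<n + 1]"
  have xs_set: "set xs \<subseteq> insert (x, x') G" and len: "length xs = n"
    using s(1) by (auto simp: xs_def)
  have sum: "(\<Sum>i=1..n. s' i (s (i + 1) - s i)) = chain_sum xs (s (n + 1))"
    using chain_sum_map_upt[of 1 "n + 1" s s']
    by (simp add: xs_def atLeastLessThanSuc_atLeastAtMost del: upt_Suc)
  have start: "chain_start xs (s (n + 1)) = s 1"
    unfolding xs_def by (rule chain_start_map_upt) simp
  show "(\<Sum>i=1..n. s' i (s (i + 1) - s i)) \<le> 0"
  proof (cases "(x, x') \<in> set xs")
    case False
    then have "\<forall>i\<in>{1..n}. (s i, s' i) \<in> G"
      using s(1) by (fastforce simp: xs_def image_iff)
    then show ?thesis using mono s(2) unfolding n_monotone_def by blast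
  next
    case True
    then obtain ys zs where yz: "xs = ys @ (x, x') # zs"
      by (auto simp: in_set_conv_decomp)
    have s1: "s 1 = chain_start ys x"
      using start by (simp add: yz chain_start_append)
    have short: "chain_sum us x + x' (chain_start us x - x) \<le> 0"
      if us: "set us \<subseteq> G" "length us \<le> n - 1" "us \<noteq> []" for us
    proof -
      obtain p vs where p: "us = p # vs" using us(3) by (cases us) auto
      define ws where "ws = replicate (n - 1 - length us) p @ us"
      have "set ws \<subseteq> G" "length ws = n - 1"
        using us p by (auto simp: ws_def)
      then have "chain_sum ws x + x' (chain_start ws x - x) \<le> 0"
        by (rule G)
      then show ?thesis
        unfolding ws_def p chain_sum_pad chain_start_pad by simp
    qed
    \<comment> \<open>In the rotated cycle, \<open>(x, x')\<close> is followed by \<open>zs\<close>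
      and then \<open>ys\<close>, which are \<open>n - 1\<close> points in all.\<close>
    have "chain_sum (zs @ ys) x + x' (chain_start (zs @ ys) x - x) \<le> 0"
    proof (rule chain_sum_insert_le[OF short])
      show "set (zs @ ys) \<subseteq> insert (x, x') G" using xs_set by (auto simp: yz)
      show "length (zs @ ys) \<le> n - 1" using len by (simp add: yz)
    qed
    then show ?thesis
      unfolding sum s(2)
      by (simp add: yz chain_sum_append chain_start_append s1[unfolded One_nat_def])
  qed
qed

section \<open>Affine minorants of the Fitzpatrick function and bounds on its conjugate\<close>

lemma fitzpatrick_ge:
  assumes n: "n \<ge> 2" and xs: "set xs \<subseteq> op_graph S" "length xs = n - 1"
  shows "ereal (chain_sum xs y + blinfun_apply y' (chain_start xs y)) \<le> fitzpatrick S n (y, y')"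
proof -
  \<comment> \<open>List positions start at 0, chain indices at 1; index \<open>n\<close> holds the
    endpoint \<open>y\<close>, so the last increment fits the general formula.\<close>
  define s where "s i = (if i = n then y else fst (xs ! (i - 1)))" for i
  define s' where "s' i = snd (xs ! (i - 1))" for i
  have eq: "xs = map (\<lambda>i. (s i, s' i)) [1..<n]"
    using xs(2) by (intro nth_equalityI) (auto simp: s_def s'_def)
  have sn: "s n = y" by (simp add: s_def)
  have n1: "{1..<n} = insert (n - 1) {1..n - 2}"
    using n by auto
  have "chain_sum xs y = (\<Sum>i=1..<n. s' i (s (i + 1) - s i))"
    using chain_sum_map_upt[of 1 n s s'] n unfolding eq[symmetric] sn by simp
  also have "\<dots> = (\<Sum>i=1..n-2. s' i (s (i + 1) - s i)) + s' (n - 1) (y - s (n - 1))"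
    unfolding n1 using n sn by (subst sum.insert) (auto simp: Suc_diff_le numeral_2_eq_2)
  finally have sum: "chain_sum xs y = \<dots>" .
  have start: "chain_start xs y = s 1"
    using chain_start_map_upt[of 1 n s s'] n unfolding eq[symmetric] sn by simp
  have "\<forall>i\<in>{1..n-1}. (s i, s' i) \<in> op_graph S"
  proof
    fix i assume "i \<in> {1..n-1}"
    then have "(s i, s' i) \<in> set xs"
      using n by (subst eq) auto
    with xs(1) show "(s i, s' i) \<in> op_graph S" by blast
  qed
  then show ?thesis
    unfolding fitzpatrick_def sum start prod.case by (intro Sup_upper CollectI exI[of _ s] exI[of _ s'] conjI refl)
qed

text \<open>At fixed \<open>(y, y')\<close> the value is linear in the triple, and the reals below
  \<open>F\<close> form a convex set, so its preimage is convex and contains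
  \<open>T\<close>.\<close>

lemma convex_hull_minorant:
  fixes T :: "(real \<times> 'a::real_normed_vector \<times> 'a dual) set" and F :: ereal
  assumes T: "\<And>c v v'. (c, v, v') \<in> T \<Longrightarrow> ereal (c + blinfun_apply v' y + blinfun_apply y' v) \<le> F"
    and "(c, v, v') \<in> convex hull T"
  shows "ereal (c + blinfun_apply v' y + blinfun_apply y' v) \<le> F"
proof -
  define L where "L t = fst t + snd (snd t) y + y' (fst (snd t))" for t :: "real \<times> 'a \<times> 'a dual"
  have "linear L"
    by (rule linearI) (simp_all add: L_def blinfun.bilinear_simps algebra_simps)
  moreover have "convex {r. ereal r \<le> F}"
  proof (cases F)
    case (real f)
    then have "{r. ereal r \<le> F} = {..f}" by auto
    then show ?thesis by simp
  qed auto
  ultimately have "convex (L -` {r. ereal r \<le> F})"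
    by (rule convex_linear_vimage)
  moreover have "T \<subseteq> L -` {r. ereal r \<le> F}"
    using T by (auto simp: L_def)
  ultimately have "convex hull T \<subseteq> L -` {r. ereal r \<le> F}"
    by (rule hull_minimal[rotated])
  with assms(2) show ?thesis by (auto simp: L_def)
qed

text \<open>The linear part of the minorant cancels the coupling terms, leaving \<open>- c\<close>.
  The minorant excludes the value minus infinity of \<open>f\<close>.\<close>

lemma fenchel_conjugate_le:
  fixes f :: "'a::real_normed_vector \<times> 'a dual \<Rightarrow> ereal"
  assumes "\<And>y y'. ereal (c + blinfun_apply v' y + blinfun_apply y' v) \<le> f (y, y')"
  shows "fenchel_conjugate f (v', v) \<le> ereal (- c)"
  unfolding fenchel_conjugate_def prod.case
proof (intro SUP_least, clarify)
  fix y and y' :: "'a dual"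
  show "ereal (v' y + y' v) - f (y, y') \<le> ereal (- c)"
    using assms[of y y'] by (cases "f (y, y')") auto
qed

theorem theorem4:
  fixes S :: "'a::banach \<Rightarrow> 'a dual set"
    and B :: "'a \<Rightarrow> 'a dual"
    and n :: nat
  assumes "reflexive_space TYPE('a)"
    and "n \<ge> 2"
    and "n_monotone n (op_graph S)"
    and "op_graph S \<noteq> {}"
    and "\<forall>(x' :: 'a dual) (x :: 'a).
           ereal (blinfun_apply x' x) \<le> fenchel_conjugate (fitzpatrick S n) (x', x)"
    and "linear B"
    and "continuous_on UNIV B"
    and "monotone_operator B"
    and "strongly_coercive B"
  shows "\<forall>w' :: 'a dual. \<exists>x \<in> closure (convex hull (op_dom S)).
           n_monotone n ({(x, w' - B x)} \<union> op_graph S)"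
proof
  fix w' :: "'a dual"
  define \<C> where "\<C> = {xs. set xs \<subseteq> op_graph S \<and> length xs = n - 1}"
  \<comment> \<open>The endpoint 0 extracts the constant term of \<open>chain_sum\<close>; the start
    of a nonempty chain does not depend on the endpoint.\<close>
  define \<tau> where "\<tau> xs = (chain_sum xs 0, chain_start xs 0, snd (last xs))" for xs :: "('a \<times> 'a dual) list"
  have ne: "xs \<noteq> []" if "xs \<in> \<C>" for xs
    using that \<open>n \<ge> 2\<close> by (auto simp: \<C>_def)
  obtain p where "p \<in> op_graph S" using assms(4) by blast
  then have "replicate (n - 1) p \<in> \<C>" by (auto simp: \<C>_def)
  then have T_ne: "\<tau> ` \<C> \<noteq> {}" by blast
  \<comment> \<open>Here the hypothesis on the conjugate enters: the triple is an affine minorant of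
    the Fitzpatrick function, so \<open>v' v\<close> is at most the conjugate at
    \<open>(v', v)\<close>, hence at most \<open>- c\<close>.\<close>
  have comb: "c + blinfun_apply v' v \<le> 0" if c: "(c, v, v') \<in> convex hull (\<tau> ` \<C>)" for c v v'
  proof -
    have "ereal (c + blinfun_apply v' y + blinfun_apply y' v) \<le> fitzpatrick S n (y, y')" for y y'
    proof (rule convex_hull_minorant[OF _ c])
      fix d u u'
      assume "(d, u, u') \<in> \<tau> ` \<C>"
      then obtain xs where xs: "xs \<in> \<C>" "d = chain_sum xs 0" "u = chain_start xs 0" "u' = snd (last xs)"
        by (auto simp: \<tau>_def)
      have "ereal (chain_sum xs y + blinfun_apply y' (chain_start xs y)) \<le> fitzpatrick S n (y, y')"
        using xs(1) by (intro fitzpatrick_ge assms(2)) (auto simp: \<C>_def)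
      then show "ereal (d + blinfun_apply u' y + blinfun_apply y' u) \<le> fitzpatrick S n (y, y')"
        using chain_sum_affine[OF ne, of xs y] chain_start_nonempty[OF ne, of xs y 0] xs by simp
    qed
    then have "fenchel_conjugate (fitzpatrick S n) (v', v) \<le> ereal (- c)"
      by (rule fenchel_conjugate_le)
    with assms(5) have "ereal (blinfun_apply v' v) \<le> ereal (- c)"
      by (blast intro: order_trans)
    then show ?thesis by simp
  qed
  have mono: "blinfun_apply (B x) x \<ge> 0" for x
    using assms(6,8) by (simp add: monotone_operator_linear_iff)
  obtain x where x: "x \<in> closure (convex hull ((fst \<circ> snd) ` \<tau> ` \<C>))"
    "\<forall>(c, v, v')\<in>\<tau> ` \<C>. c + blinfun_apply v' x + blinfun_apply (w' - B x) (v - x) \<le> 0"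
    using coercive_system_solvable[OF assms(1,6,7) mono assms(9) T_ne comb] by blast
  have "chain_start xs 0 \<in> op_dom S" if "xs \<in> \<C>" for xs
  proof -
    have "chain_start xs 0 \<in> fst ` op_graph S"
      using chain_start_in[OF ne, of xs 0] that by (auto simp: \<C>_def)
    then show ?thesis
      by (auto simp: op_graph_def op_dom_def)
  qed
  then have "(fst \<circ> snd) ` \<tau> ` \<C> \<subseteq> op_dom S"
    by (auto simp: \<tau>_def)
  then have "x \<in> closure (convex hull (op_dom S))"
    using x(1) closure_mono[OF hull_mono] by blast
  moreover have "n_monotone n (insert (x, w' - B x) (op_graph S))"
  proof (rule n_monotone_insert[OF assms(3)])
    fix xs assume "set xs \<subseteq> op_graph S" "length xs = n - 1"
    then have xs: "xs \<in> \<C>" by (simp add: \<C>_def)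
    \<comment> \<open>Moving the endpoint from 0 to \<open>x\<close> turns the inequality of the
      system into the cycle condition for this chain.\<close>
    then have "chain_sum xs 0 + blinfun_apply (snd (last xs)) x
        + blinfun_apply (w' - B x) (chain_start xs 0 - x) \<le> 0"
      using x(2) by (auto simp: \<tau>_def)
    then show "chain_sum xs x + blinfun_apply (w' - B x) (chain_start xs x - x) \<le> 0"
      using chain_sum_affine[OF ne[OF xs], of x] chain_start_nonempty[OF ne[OF xs], of x 0] by simp
  qed
  ultimately show "\<exists>x \<in> closure (convex hull (op_dom S)).
      n_monotone n ({(x, w' - B x)} \<union> op_graph S)"
    by (intro bexI[of _ x]) simp_all
qed

end
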